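(* Let $X$ be an atomic Archimedean vector lattice. Then order convergence is topological on every order bounded subset of $X$; that is, for every order bounded subset $B\subseteq X$ there is a topology $\tau$ on $B$ such that, for every net $(x_\alpha)$ in $B$ and every $x\in B$, $(x_\alpha)$ is order convergent to $x$ in $X$ if and only if $x_\alpha\to x$ with respect to $\tau$.
   Context: A net $(x_\alpha)_{\alpha\in A}$ in a vector lattice $X$ is order convergent to $x\in X$ if there is a net $(y_\gamma)_{\gamma\in \Gamma}$ in $X$ (with a possibly different index set) such that $y_\gamma\downarrow 0$ (decreasing with infimum $0$ in $X$) and for each $\gamma\in \Gamma$ there is $\alpha_\gamma\in A$ with $|x_\alpha-x|\le y_\gamma$ for all $\alpha\ge\alpha_\gamma$. A subset of $X$ is order bounded if it is contained in an order interval $[u,v]=\{z\in X: u\le z\le v\}$. An element $a>0$ of $X$ is an atom if for every $y\in[0,a]$ there is a real $\lambda\ge 0$ with $y=\lambda a$. $X$ is atomic if the band generated by its atoms is $X$. *)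

theory Defs
  imports "HOL-Analysis.Analysis" "HOL-Library.Lattice_Algebras" "HOL-Library.Lub_Glb"
begin

class vector_lattice = ordered_real_vector + lattice_ab_group_add_abs

class archimedean_vector_lattice = vector_lattice +
  assumes archimedean: "(\<And>n::nat. real n *\<^sub>R x \<le> y) \<Longrightarrow> x \<le> 0"

(* (a, b) \<in> r is read "b \<ge> a"; the relation need not be antisymmetric. *)
definition directed_on :: "'i set \<Rightarrow> 'i rel \<Rightarrow> bool" where
  "directed_on A r \<longleftrightarrow>
     A \<noteq> {} \<and> preorder_on A r \<and> (\<forall>a\<in>A. \<forall>b\<in>A. \<exists>c\<in>A. (a, c) \<in> r \<and> (b, c) \<in> r)"

(* The filter of tails, through which the library's limitin expresses convergence of nets. *)
definition tails :: "'i set \<Rightarrow> 'i rel \<Rightarrow> 'i filter" where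
  "tails A r = (INF a\<in>A. principal {b. (a, b) \<in> r})"

lemma eventually_tails:
  assumes "directed_on A r"
  shows "eventually P (tails A r) \<longleftrightarrow> (\<exists>a\<in>A. \<forall>b. (a, b) \<in> r \<longrightarrow> P b)"
proof -
  have "\<exists>c\<in>A. principal {z. (c, z) \<in> r} \<le> inf (principal {z. (a, z) \<in> r}) (principal {z. (b, z) \<in> r})"
    if "a \<in> A" "b \<in> A" for a b
  proof -
    obtain c where c: "c \<in> A" "(a, c) \<in> r" "(b, c) \<in> r"
      using assms \<open>a \<in> A\<close> \<open>b \<in> A\<close> unfolding directed_on_def by blast
    have "trans r"
      using assms unfolding directed_on_def preorder_on_def by blast
    then have "{z. (c, z) \<in> r} \<subseteq> {z. (a, z) \<in> r} \<inter> {z. (b, z) \<in> r}"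
      using c by (auto dest: transD)
    then show ?thesis
      using c(1) by auto
  qed
  then have "eventually P (tails A r) \<longleftrightarrow> (\<exists>a\<in>A. eventually P (principal {b. (a, b) \<in> r}))"
    unfolding tails_def using assms by (intro eventually_INF_base) (auto simp: directed_on_def)
  then show ?thesis
    by (simp add: eventually_principal)
qed

definition decreasing_to_0 :: "'g set \<Rightarrow> 'g rel \<Rightarrow> ('g \<Rightarrow> 'a::vector_lattice) \<Rightarrow> bool" where
  "decreasing_to_0 G s y \<longleftrightarrow>
     directed_on G s \<and> (\<forall>g h. (g, h) \<in> s \<longrightarrow> y h \<le> y g) \<and> isGlb UNIV (y ` G) 0"

(* The dominating net may be indexed by any directed set. Indexing it by a set of elements
   of the space is no restriction: see order_convergentI. *)
definition order_convergent ::
    "'i set \<Rightarrow> 'i rel \<Rightarrow> ('i \<Rightarrow> 'a::vector_lattice) \<Rightarrow> 'a \<Rightarrow> bool" where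
  "order_convergent A r x l \<longleftrightarrow>
     (\<exists>(G :: 'a set) s y. decreasing_to_0 G s y \<and>
        (\<forall>g\<in>G. \<exists>a\<in>A. \<forall>b. (a, b) \<in> r \<longrightarrow> \<bar>x b - l\<bar> \<le> y g))"

lemma order_convergentI:
  fixes G :: "'g set" and x :: "'i \<Rightarrow> 'a::vector_lattice"
  assumes "decreasing_to_0 G s y"
    and "\<And>g. g \<in> G \<Longrightarrow> \<exists>a\<in>A. \<forall>b. (a, b) \<in> r \<longrightarrow> \<bar>x b - l\<bar> \<le> y g"
  shows "order_convergent A r x l"
proof -
  define H where "H = y ` G"
  define t where "t = {(u, v). u \<in> H \<and> v \<in> H \<and> v \<le> u}"
  have G: "directed_on G s" "\<And>g h. (g, h) \<in> s \<Longrightarrow> y h \<le> y g" "isGlb UNIV H 0"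
    using assms(1) unfolding decreasing_to_0_def H_def by blast+
  have "\<exists>w\<in>H. (u, w) \<in> t \<and> (v, w) \<in> t" if uv: "u \<in> H" "v \<in> H" for u v
  proof -
    obtain g h where gh: "g \<in> G" "h \<in> G" "u = y g" "v = y h"
      using uv unfolding H_def by blast
    obtain k where k: "k \<in> G" "(g, k) \<in> s" "(h, k) \<in> s"
      using G(1) gh(1,2) unfolding directed_on_def by blast
    then have "y k \<le> u" "y k \<le> v" "y k \<in> H"
      using G(2) gh unfolding H_def by auto
    then show ?thesis
      using uv unfolding t_def by blast
  qed
  moreover have "H \<noteq> {}"
    using G(1) unfolding directed_on_def H_def by simp
  moreover have "preorder_on H t"
    unfolding preorder_on_def t_def refl_on_def trans_def by (auto intro: order_trans)
  ultimately have "directed_on H t"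
    unfolding directed_on_def by blast
  then have "decreasing_to_0 H t (\<lambda>u. u)"
    unfolding decreasing_to_0_def using G(3) by (auto simp: t_def)
  moreover have "\<forall>u\<in>H. \<exists>a\<in>A. \<forall>b. (a, b) \<in> r \<longrightarrow> \<bar>x b - l\<bar> \<le> u"
    unfolding H_def using assms(2) by blast
  ultimately show ?thesis
    unfolding order_convergent_def by blast
qed

(* Order convergence to points of B of the nets in B with indices in the given type
   is convergence in T. *)
definition describes_order_convergence ::
    "'i itself \<Rightarrow> 'a::vector_lattice set \<Rightarrow> 'a topology \<Rightarrow> bool" where
  "describes_order_convergence (_ :: 'i itself) B T \<longleftrightarrow>
     (\<forall>(A :: 'i set) r x l. directed_on A r \<longrightarrow> x ` A \<subseteq> B \<longrightarrow> l \<in> B \<longrightarrow>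
        (order_convergent A r x l \<longleftrightarrow> limitin T x l (tails A r)))"

(* HOL cannot quantify over index types inside a formula, but every net in the space has the
   same tails as one whose indices are pairs of a set and an element of it; so this one index
   type accounts for all. *)
lemma describes_order_convergence_universal:
  fixes B :: "'a::vector_lattice set"
  assumes univ: "describes_order_convergence TYPE('a set \<times> 'a) B T"
  shows "describes_order_convergence TYPE('i) B T"
  unfolding describes_order_convergence_def
proof (intro allI impI)
  fix A :: "'i set" and r x l
  assume A: "directed_on A r" and x: "x ` A \<subseteq> B" and l: "l \<in> B"
  have r: "r \<subseteq> A \<times> A" "trans r" "\<And>a. a \<in> A \<Longrightarrow> (a, a) \<in> r"
    using A unfolding directed_on_def preorder_on_def refl_on_def by blast+
  define tl where "tl a = x ` {b. (a, b) \<in> r}" for a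
  define C where "C = {(S, z). (\<exists>a\<in>A. S = tl a) \<and> z \<in> S}"
  define s where "s = {(p, q). p \<in> C \<and> q \<in> C \<and> fst q \<subseteq> fst p}"
  have self: "x a \<in> tl a" if "a \<in> A" for a
    using r(3)[OF that] unfolding tl_def by blast
  have mono: "tl c \<subseteq> tl a" if "(a, c) \<in> r" for a c
    using that r(2) unfolding tl_def by (auto dest: transD)
  have "C \<noteq> {}"
    using A self unfolding directed_on_def C_def by blast
  moreover have "preorder_on C s"
    unfolding preorder_on_def s_def refl_on_def trans_def by auto
  moreover have "\<exists>w\<in>C. (p, w) \<in> s \<and> (q, w) \<in> s" if pq: "p \<in> C" "q \<in> C" for p q
  proof -
    obtain a b where ab: "a \<in> A" "b \<in> A" "fst p = tl a" "fst q = tl b"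
      using pq unfolding C_def by auto
    obtain c where c: "c \<in> A" "(a, c) \<in> r" "(b, c) \<in> r"
      using A ab(1,2) unfolding directed_on_def by blast
    have "(tl c, x c) \<in> C"
      using c(1) self unfolding C_def by blast
    then show ?thesis
      using pq ab(3,4) mono[OF c(2)] mono[OF c(3)] unfolding s_def
      by (intro bexI[of _ "(tl c, x c)"]) auto
  qed
  ultimately have C: "directed_on C s"
    unfolding directed_on_def by blast
  have eq: "(\<exists>p\<in>C. \<forall>q. (p, q) \<in> s \<longrightarrow> P (snd q)) \<longleftrightarrow> (\<exists>a\<in>A. \<forall>b. (a, b) \<in> r \<longrightarrow> P (x b))" for P
  proof
    assume "\<exists>p\<in>C. \<forall>q. (p, q) \<in> s \<longrightarrow> P (snd q)"
    then obtain p where p: "p \<in> C" "\<And>q. (p, q) \<in> s \<Longrightarrow> P (snd q)" by blast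
    obtain a where a: "a \<in> A" "fst p = tl a"
      using p(1) unfolding C_def by auto
    have "P (x b)" if "(a, b) \<in> r" for b
    proof -
      have "(tl a, x b) \<in> C"
        using a(1) that unfolding C_def tl_def by blast
      then have "(p, (tl a, x b)) \<in> s"
        using p(1) a(2) unfolding s_def by simp
      then show ?thesis
        using p(2) by fastforce
    qed
    then show "\<exists>a\<in>A. \<forall>b. (a, b) \<in> r \<longrightarrow> P (x b)"
      using a(1) by blast
  next
    assume "\<exists>a\<in>A. \<forall>b. (a, b) \<in> r \<longrightarrow> P (x b)"
    then obtain a where a: "a \<in> A" "\<And>b. (a, b) \<in> r \<Longrightarrow> P (x b)" by blast
    have "(tl a, x a) \<in> C"
      using a(1) self unfolding C_def by blast
    moreover have "P (snd q)" if "((tl a, x a), q) \<in> s" for q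
    proof -
      have "snd q \<in> tl a"
        using that unfolding s_def C_def by auto
      then show ?thesis
        using a(2) unfolding tl_def by auto
    qed
    ultimately show "\<exists>p\<in>C. \<forall>q. (p, q) \<in> s \<longrightarrow> P (snd q)"
      by blast
  qed
  have "tl a \<subseteq> B" if "a \<in> A" for a
    using r(1) x unfolding tl_def by blast
  then have "snd ` C \<subseteq> B"
    unfolding C_def by fastforce
  then have "order_convergent C s snd l \<longleftrightarrow> limitin T snd l (tails C s)"
    using univ C l unfolding describes_order_convergence_def by blast
  moreover have "order_convergent C s snd l \<longleftrightarrow> order_convergent A r x l"
    unfolding order_convergent_def eq[of "\<lambda>z. \<bar>z - l\<bar> \<le> _"] ..
  moreover have "limitin T snd l (tails C s) \<longleftrightarrow> limitin T x l (tails A r)"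
    unfolding limitin_def eventually_tails[OF C] eventually_tails[OF A] eq[of "\<lambda>z. z \<in> _"] ..
  ultimately show "order_convergent A r x l \<longleftrightarrow> limitin T x l (tails A r)"
    by simp
qed

definition order_bounded :: "'a::vector_lattice set \<Rightarrow> bool" where
  "order_bounded B \<longleftrightarrow> (\<exists>u v. B \<subseteq> {u..v})"

definition atom :: "'a::vector_lattice \<Rightarrow> bool" where
  "atom a \<longleftrightarrow> 0 < a \<and> (\<forall>y\<in>{0..a}. \<exists>c\<ge>0. y = c *\<^sub>R a)"

definition order_ideal :: "'a::vector_lattice set \<Rightarrow> bool" where
  "order_ideal J \<longleftrightarrow> subspace J \<and> (\<forall>y\<in>J. \<forall>x. \<bar>x\<bar> \<le> \<bar>y\<bar> \<longrightarrow> x \<in> J)"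

definition band :: "'a::vector_lattice set \<Rightarrow> bool" where
  "band J \<longleftrightarrow> order_ideal J \<and> (\<forall>D x. D \<subseteq> J \<longrightarrow> isLub UNIV D x \<longrightarrow> x \<in> J)"

definition band_generated :: "'a::vector_lattice set \<Rightarrow> 'a set" where
  "band_generated S = band hull S"

definition atomic_space :: "'a::vector_lattice itself \<Rightarrow> bool" where
  "atomic_space (_ :: 'a itself) \<longleftrightarrow> band_generated {a::'a. atom a} = UNIV"

end

theory Submission
  imports Defs
begin

text \<open>
  Order convergence of nets in an order bounded set is convergence in every atomic coordinate.
  For an atom \<open>a\<close> the element \<open>\<bar>z\<bar> \<sqinter> a\<close> is a multiple \<open>c a\<close>, and
  the number \<open>c\<close>, the gauge of \<open>z\<close> at \<open>a\<close>, is symmetric, monotone and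
  subadditive in \<open>z\<close>. So the gauges of differences are pseudometrics, and they generate
  the required topology on \<open>B\<close>.

  If a net converges in order and \<open>y\<^sub>\<gamma>\<close> decreases to \<open>0\<close> and dominates it, then the
  gauge of \<open>y\<^sub>\<gamma>\<close> at \<open>a\<close> falls below every \<open>\<epsilon> > 0\<close>, for otherwise
  \<open>\<epsilon> a\<close> would be a lower bound of all \<open>y\<^sub>\<gamma>\<close>.

  Conversely, suppose that all gauges of \<open>x\<^sub>\<alpha> - l\<close> tend to \<open>0\<close>. The elements
  that eventually bound \<open>\<bar>x\<^sub>\<alpha> - l\<bar>\<close> are directed downwards, and there are some
  because \<open>B\<close> is order bounded; it must be shown that their infimum is \<open>0\<close>. In an
  atomic space every element \<open>z > 0\<close> lies above an atom
  (\<open>atomic_space_positive_ge_atom\<close>), so otherwise some atom \<open>a\<close> lies below all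
  eventual bounds. Once the gauge at \<open>a\<close> is at most \<open>1/2\<close>, any eventual bound
  \<open>y \<ge> a\<close> can be lowered to \<open>y - a/2\<close> (\<open>lower_bound_by_half_atom\<close>).
  Repeating this gives \<open>n a/2 \<le> y\<close> for all \<open>n\<close>, which the Archimedean
  property excludes.
\<close>

section \<open>Disjointness in vector lattices\<close>

lemma scaleR_le_scaleR_pos_iff:
  fixes a :: "'a::ordered_real_vector"
  assumes "0 < a"
  shows "c *\<^sub>R a \<le> d *\<^sub>R a \<longleftrightarrow> c \<le> d"
proof -
  have "c *\<^sub>R a \<le> d *\<^sub>R a \<longleftrightarrow> 0 \<le> (d - c) *\<^sub>R a"
    by (simp add: scaleR_diff_left)
  also have "\<dots> \<longleftrightarrow> c \<le> d"
    using assms by (auto simp: zero_le_scaleR_iff)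
  finally show ?thesis .
qed

lemma scaleR_inf_distrib:
  fixes x y :: "'a::vector_lattice"
  assumes "0 < c"
  shows "c *\<^sub>R inf x y = inf (c *\<^sub>R x) (c *\<^sub>R y)"
proof (rule antisym)
  show "c *\<^sub>R inf x y \<le> inf (c *\<^sub>R x) (c *\<^sub>R y)"
    using assms by (simp add: scaleR_left_mono)
  have "inverse c *\<^sub>R inf (c *\<^sub>R x) (c *\<^sub>R y) \<le> inf x y"
    using assms scaleR_left_mono[of "inf (c *\<^sub>R x) (c *\<^sub>R y)" "c *\<^sub>R x" "inverse c"]
      scaleR_left_mono[of "inf (c *\<^sub>R x) (c *\<^sub>R y)" "c *\<^sub>R y" "inverse c"] by simp
  then have "c *\<^sub>R (inverse c *\<^sub>R inf (c *\<^sub>R x) (c *\<^sub>R y)) \<le> c *\<^sub>R inf x y"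
    using assms by (intro scaleR_left_mono) auto
  then show "inf (c *\<^sub>R x) (c *\<^sub>R y) \<le> c *\<^sub>R inf x y"
    using assms by simp
qed

lemma inf_add_le_add_inf:
  fixes x y z :: "'a::vector_lattice"
  assumes "0 \<le> x" "0 \<le> y" "0 \<le> z"
  shows "inf (x + y) z \<le> inf x z + inf y z"
proof -
  have "inf x z + inf y z = inf (inf (x + y) (x + z)) (inf (z + y) (z + z))"
    by (simp add: add_inf_distrib_left add_inf_distrib_right inf.assoc inf.left_commute)
  moreover have "z \<le> x + z" "z \<le> z + y" "z \<le> z + z"
    using assms by auto
  ultimately show ?thesis
    by (auto intro: le_infI2)
qed

lemma disjoint_le_add_cancel:
  fixes s p q :: "'a::vector_lattice"
  assumes "0 \<le> s" "0 \<le> p" "0 \<le> q" "inf s q = 0" "s \<le> p + q"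
  shows "s \<le> p"
proof -
  have "s = inf (p + q) s"
    using assms(5) by (simp add: inf_absorb2)
  also have "\<dots> \<le> inf p s + inf q s"
    using assms by (intro inf_add_le_add_inf)
  also have "\<dots> \<le> p"
    using assms(4) by (simp add: inf_commute)
  finally show ?thesis .
qed

lemma disjoint_scaleR:
  fixes s q :: "'a::vector_lattice"
  assumes "0 \<le> s" "0 \<le> q" "inf s q = 0" "0 \<le> c"
  shows "inf (c *\<^sub>R s) q = 0"
proof (rule antisym)
  define m where "m = max 1 c"
  have m: "0 < m" "c \<le> m" "1 \<le> m"
    by (auto simp: m_def)
  have "q \<le> m *\<^sub>R q"
    using scaleR_right_mono[OF m(3) assms(2)] by simp
  then have "inf (c *\<^sub>R s) q \<le> inf (m *\<^sub>R s) (m *\<^sub>R q)"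
    using m assms by (intro inf_mono scaleR_right_mono)
  also have "\<dots> = 0"
    using assms(3) m(1) by (simp flip: scaleR_inf_distrib)
  finally show "inf (c *\<^sub>R s) q \<le> 0" .
  show "0 \<le> inf (c *\<^sub>R s) q"
    using assms by (simp add: scaleR_nonneg_nonneg)
qed

section \<open>Atoms below positive elements\<close>

text \<open>
  The delicate point is closure under suprema of sets that need be neither positive nor
  directed. Subtracting a member \<open>d\<^sub>0\<close> turns such a set into one whose positive parts have
  supremum \<open>x - d\<^sub>0\<close>; these are disjoint from \<open>z\<close>, hence still below
  \<open>(x - d\<^sub>0) - (x - d\<^sub>0) \<sqinter> z\<close>.
\<close>
lemma band_disjoint_complement:
  fixes z :: "'a::vector_lattice"
  assumes z: "0 \<le> z"
  shows "band {x. inf \<bar>x\<bar> z = 0}"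
proof -
  let ?J = "{x. inf \<bar>x\<bar> z = 0}"
  have down: "x \<in> ?J" if "y \<in> ?J" "\<bar>x\<bar> \<le> \<bar>y\<bar>" for x y
  proof -
    have "inf \<bar>x\<bar> z \<le> (inf \<bar>y\<bar> z)"
      using that(2) by (intro inf_mono order_refl)
    also have "\<dots> = 0"
      using that(1) by simp
    finally have "inf \<bar>x\<bar> z \<le> 0" .
    moreover have "0 \<le> inf \<bar>x\<bar> z"
      using z by simp
    ultimately show ?thesis
      by simp
  qed
  have sub: "subspace ?J"
    unfolding subspace_def
  proof (intro conjI ballI allI)
    show "0 \<in> ?J"
      using z by (simp add: inf_absorb1)
  next
    fix x y assume xy: "x \<in> ?J" "y \<in> ?J"
    have "inf \<bar>x + y\<bar> z \<le> inf (\<bar>x\<bar> + \<bar>y\<bar>) z"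
      by (intro inf_mono abs_triangle_ineq) auto
    also have "\<dots> \<le> inf \<bar>x\<bar> z + inf \<bar>y\<bar> z"
      using z by (intro inf_add_le_add_inf) auto
    finally have "inf \<bar>x + y\<bar> z \<le> 0"
      using xy by simp
    moreover have "0 \<le> inf \<bar>x + y\<bar> z"
      using z by simp
    ultimately show "x + y \<in> ?J"
      by simp
  next
    fix c :: real and x assume x: "x \<in> ?J"
    have le: "d *\<^sub>R y \<le> d *\<^sub>R \<bar>x\<bar>" if "0 \<le> d" "y = x \<or> y = - x" for d y
      using that abs_ge_self[of x] abs_ge_minus_self[of x] by (auto intro!: scaleR_left_mono)
    have "\<bar>c *\<^sub>R x\<bar> \<le> \<bar>c\<bar> *\<^sub>R \<bar>x\<bar>"
    proof (rule abs_leI)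
      show "c *\<^sub>R x \<le> \<bar>c\<bar> *\<^sub>R \<bar>x\<bar>"
        using le[of "\<bar>c\<bar>" x] le[of "\<bar>c\<bar>" "- x"] by (cases "0 \<le> c") auto
      show "- (c *\<^sub>R x) \<le> \<bar>c\<bar> *\<^sub>R \<bar>x\<bar>"
        using le[of "\<bar>c\<bar>" x] le[of "\<bar>c\<bar>" "- x"] by (cases "0 \<le> c") auto
    qed
    moreover have "inf (\<bar>c\<bar> *\<^sub>R \<bar>x\<bar>) z = 0"
      using x z by (intro disjoint_scaleR) auto
    moreover have "0 \<le> \<bar>c\<bar> *\<^sub>R \<bar>x\<bar>"
      by (intro scaleR_nonneg_nonneg) auto
    ultimately show "c *\<^sub>R x \<in> ?J"
      using down[of "\<bar>c\<bar> *\<^sub>R \<bar>x\<bar>" "c *\<^sub>R x"] by simp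
  qed
  have "x \<in> ?J" if D: "D \<subseteq> ?J" and lub: "isLub UNIV D x" for D x
  proof -
    have ub: "d \<le> x" if "d \<in> D" for d
      using isLubD2[OF lub that] .
    have least: "x \<le> y" if "\<And>d. d \<in> D \<Longrightarrow> d \<le> y" for y
      using isLub_le_isUb[OF lub] that by (simp add: isUb_def setle_def)
    show ?thesis
    proof (cases "D = {}")
      case True
      \<comment> \<open>A supremum of the empty set is a least element, and only a trivial space has one.\<close>
      then have "x \<le> x + x" "x \<le> 0"
        by (intro least; simp add: True)+
      then have "x = 0"
        by simp
      then show ?thesis
        using subspace_0[OF sub] by simp
    next
      case False
      then obtain d0 where d0: "d0 \<in> D"
        by blast
      define x' where "x' = x - d0"
      define e where "e = inf x' z"
      have x': "0 \<le> x'"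
        using ub[OF d0] by (simp add: x'_def)
      have e: "0 \<le> e" "e \<le> x'" "e \<le> z"
        using x' z by (auto simp: e_def)
      have "d \<le> x - e" if d: "d \<in> D" for d
      proof -
        define s where "s = sup (d - d0) 0"
        have s: "0 \<le> s" "s \<le> x'"
          using ub[OF d] x' by (auto simp: s_def x'_def)
        have "d - d0 \<in> ?J"
          using subspace_diff[OF sub] d d0 D by blast
        moreover have "\<bar>s\<bar> \<le> \<bar>d - d0\<bar>"
          using s(1) by (simp add: s_def abs_ge_self)
        ultimately have "s \<in> ?J"
          by (rule down)
        then have "inf s z = 0"
          using s(1) by simp
        moreover have "inf s e \<le> inf s z"
          using e(3) by (intro inf_mono) auto
        ultimately have "inf s e = 0"
          using s(1) e(1) by (auto intro: antisym)
        then have "s \<le> x' - e"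
          using s e by (intro disjoint_le_add_cancel[of s "x' - e" e]) auto
        moreover have "d - d0 \<le> s"
          by (simp add: s_def)
        ultimately have "d - d0 \<le> x - d0 - e"
          unfolding x'_def by (rule order_trans[rotated])
        then show ?thesis
          by (simp add: algebra_simps)
      qed
      then have "x \<le> x - e"
        by (rule least)
      then have "e = 0"
        using e(1) by simp
      then have "x' \<in> ?J"
        using x' by (simp add: e_def)
      then have "x' + d0 \<in> ?J"
        using subspace_add[OF sub] d0 D by blast
      then show ?thesis
        by (simp add: x'_def)
    qed
  qed
  then show ?thesis
    unfolding band_def order_ideal_def using sub down by blast
qed

lemma atom_scaleR:
  assumes "atom a" "0 < c"
  shows "atom (c *\<^sub>R a)"
  unfolding atom_def
proof (intro conjI ballI)
  have a: "0 < a" "\<And>y. 0 \<le> y \<Longrightarrow> y \<le> a \<Longrightarrow> \<exists>d\<ge>0. y = d *\<^sub>R a"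
    using assms(1) by (auto simp: atom_def)
  show "0 < c *\<^sub>R a"
    using a(1) assms(2) by (auto simp: less_le intro: scaleR_nonneg_nonneg)
  fix y assume y: "y \<in> {0..c *\<^sub>R a}"
  have "inverse c *\<^sub>R y \<le> inverse c *\<^sub>R (c *\<^sub>R a)"
    using y assms(2) by (intro scaleR_left_mono) auto
  then have "inverse c *\<^sub>R y \<le> a"
    using assms(2) by simp
  moreover have "0 \<le> inverse c *\<^sub>R y"
    using y assms(2) by (intro scaleR_nonneg_nonneg) auto
  ultimately obtain d where d: "d \<ge> 0" "inverse c *\<^sub>R y = d *\<^sub>R a"
    using a(2) by blast
  then have "y = c *\<^sub>R (d *\<^sub>R a)"
    using assms(2) by (metis less_irrefl right_inverse scaleR_one scaleR_scaleR)
  then show "\<exists>d\<ge>0. y = d *\<^sub>R c *\<^sub>R a"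
    using d(1) by (auto simp: mult.commute)
qed

text \<open>
  An element \<open>z > 0\<close> above no atom is disjoint from all atoms, so that its disjoint complement is
  a band containing them. This band is the whole space, and \<open>z\<close> is disjoint from itself.
\<close>
lemma atomic_space_positive_ge_atom:
  fixes z :: "'a::vector_lattice"
  assumes "atomic_space TYPE('a)" "0 < z"
  shows "\<exists>a. atom a \<and> a \<le> z"
proof (rule ccontr)
  assume no: "\<nexists>a. atom a \<and> a \<le> z"
  have "inf \<bar>a\<bar> z = 0" if a: "atom a" for a
  proof -
    have a0: "0 < a"
      using a by (simp add: atom_def)
    have "inf a z \<in> {0..a}"
      using a0 assms(2) by (simp add: less_imp_le)
    then obtain c where c: "c \<ge> 0" "inf a z = c *\<^sub>R a"
      using a unfolding atom_def by blast
    have "\<not> 0 < c"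
      using atom_scaleR[OF a] no c(2) by (metis inf.cobounded2)
    then show ?thesis
      using c a0 by simp
  qed
  then have "band hull {a. atom a} \<subseteq> {x. inf \<bar>x\<bar> z = 0}"
    using assms(2) by (intro hull_minimal band_disjoint_complement) auto
  then have "z \<in> {x. inf \<bar>x\<bar> z = 0}"
    using assms(1) by (auto simp: atomic_space_def band_generated_def)
  then show False
    using assms(2) by simp
qed

section \<open>The gauge of an atom\<close>

text \<open>
  The defining equation has exactly one solution whenever \<open>a\<close> is an atom. Truncating
  \<open>\<bar>z\<bar>\<close> at \<open>a\<close> gives a value in \<open>[0, 1]\<close>; it loses nothing about
  convergence to \<open>0\<close> and avoids the construction of linear coordinate functionals.
\<close>
definition gauge_at :: "'a::vector_lattice \<Rightarrow> 'a \<Rightarrow> real" where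
  "gauge_at a z = (THE c. inf \<bar>z\<bar> a = c *\<^sub>R a)"

lemma inf_atom_eq_gauge_at:
  assumes "atom a"
  shows "inf \<bar>z\<bar> a = gauge_at a z *\<^sub>R a"
proof -
  have a: "0 < a"
    using assms by (simp add: atom_def)
  have "inf \<bar>z\<bar> a \<in> {0..a}"
    using a by (simp add: less_imp_le)
  then obtain c where c: "inf \<bar>z\<bar> a = c *\<^sub>R a"
    using assms unfolding atom_def by blast
  show ?thesis
    unfolding gauge_at_def
    by (rule theI[of _ c]) (use a c in auto)
qed

lemma gauge_at_le_iff:
  assumes "atom a"
  shows "gauge_at a z \<le> c \<longleftrightarrow> inf \<bar>z\<bar> a \<le> c *\<^sub>R a"
proof -
  have "0 < a"
    using assms by (simp add: atom_def)
  then show ?thesis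
    by (simp add: inf_atom_eq_gauge_at[OF assms] scaleR_le_scaleR_pos_iff)
qed

lemma gauge_at_mono:
  assumes "atom a" "\<bar>y\<bar> \<le> \<bar>z\<bar>"
  shows "gauge_at a y \<le> gauge_at a z"
proof -
  have "inf \<bar>y\<bar> a \<le> (inf \<bar>z\<bar> a)"
    by (rule inf_mono[OF assms(2) order_refl])
  then show ?thesis
    by (simp only: gauge_at_le_iff[OF assms(1)] inf_atom_eq_gauge_at[OF assms(1), of z])
qed

lemma gauge_at_0:
  assumes "atom a"
  shows "gauge_at a 0 = 0"
proof -
  have a: "0 < a"
    using assms by (simp add: atom_def)
  then have "gauge_at a 0 *\<^sub>R a = 0"
    by (simp add: less_imp_le inf_absorb1 flip: inf_atom_eq_gauge_at[OF assms])
  then show ?thesis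
    using a by auto
qed

text \<open>This is the triangle inequality of the pseudometric that belongs to \<open>a\<close>.\<close>
lemma gauge_at_add_le:
  assumes "atom a"
  shows "gauge_at a (y + z) \<le> gauge_at a y + gauge_at a z"
proof -
  have a: "0 \<le> a"
    using assms by (simp add: atom_def less_imp_le)
  have "inf \<bar>y + z\<bar> a \<le> inf (\<bar>y\<bar> + \<bar>z\<bar>) a"
    by (intro inf_mono abs_triangle_ineq) auto
  also have "\<dots> \<le> inf \<bar>y\<bar> a + inf \<bar>z\<bar> a"
    using a by (intro inf_add_le_add_inf) auto
  also have "\<dots> = (gauge_at a y + gauge_at a z) *\<^sub>R a"
    by (simp add: inf_atom_eq_gauge_at[OF assms] scaleR_add_left)
  finally show ?thesis
    by (simp add: gauge_at_le_iff[OF assms])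
qed

text \<open>
  If all gauges were at least \<open>e\<close>, then \<open>e a\<close> would be a positive lower bound of
  the net.
\<close>
lemma decreasing_to_0_gauge_at_small:
  assumes "decreasing_to_0 G s y" "atom a" "0 < e"
  shows "\<exists>g\<in>G. gauge_at a (y g) < e"
proof (rule ccontr)
  assume "\<not> ?thesis"
  then have ge: "e \<le> gauge_at a (y g)" if "g \<in> G" for g
    using that by (auto simp: not_less)
  have a: "0 < a"
    using assms(2) by (simp add: atom_def)
  have glb: "isGlb UNIV (y ` G) 0"
    using assms(1) by (simp add: decreasing_to_0_def)
  have "e *\<^sub>R a \<le> y g" if g: "g \<in> G" for g
  proof -
    have "e *\<^sub>R a \<le> inf \<bar>y g\<bar> a"
      using ge[OF g] a by (simp add: inf_atom_eq_gauge_at[OF assms(2)] scaleR_le_scaleR_pos_iff)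
    moreover have "0 \<le> y g"
      using isGlbD2[OF glb] g by simp
    ultimately show ?thesis
      by simp
  qed
  then have "e *\<^sub>R a \<le> 0"
    using glb by (auto simp: isGlb_def greatestP_def isLb_def setge_def setle_def)
  then show False
    using scaleR_le_scaleR_pos_iff[OF a, of e 0] assms(3) by simp
qed

text \<open>
  Write \<open>h = a/2\<close>. Since \<open>t\<close> has at most \<open>h\<close> in the direction of
  \<open>a\<close>, what exceeds \<open>h\<close> in \<open>t\<close>, namely \<open>t - t \<sqinter> h\<close>, is
  disjoint from \<open>a\<close>. It lies below \<open>y = (y - a) + a\<close>, hence already below
  \<open>y - a\<close>.
\<close>
lemma lower_bound_by_half_atom:
  fixes a t y :: "'a::vector_lattice"
  assumes "atom a" "gauge_at a t \<le> 1/2" "0 \<le> t" "t \<le> y" "a \<le> y"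
  shows "t \<le> y - (1/2) *\<^sub>R a"
proof -
  define h where "h = (1/2) *\<^sub>R a"
  define s where "s = t - inf t h"
  have a: "0 \<le> a"
    using assms(1) by (simp add: atom_def less_imp_le)
  then have h: "0 \<le> h" "h + h = a"
    by (auto simp: h_def simp flip: scaleR_add_left intro: scaleR_nonneg_nonneg)
  have s: "0 \<le> s" "s \<le> t"
    unfolding s_def using assms(3) h(1) by (simp_all only: diff_ge_0_iff_ge diff_le_eq
        le_add_same_cancel1 inf.cobounded1 le_inf_iff simp_thms)
  have t: "s + inf t h = t"
    unfolding s_def by (rule diff_add_cancel)
  have "inf t a \<le> h"
    using assms(2,3) unfolding gauge_at_le_iff[OF assms(1)] by (simp add: h_def)
  \<comment> \<open>To see that \<open>h\<close> and \<open>s\<close> are disjoint, add their common part to \<open>t \<sqinter> h\<close>: the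
    sum is still below \<open>t\<close> and \<open>a\<close>, and \<open>t \<sqinter> a \<le> h\<close>.\<close>
  define e where "e = inf h s"
  have "e + inf t h \<le> s + inf t h" "e + inf t h \<le> h + h"
    by (auto simp: e_def intro!: add_mono)
  then have "e + inf t h \<le> inf t a"
    by (simp only: t h(2) le_inf_iff simp_thms)
  then have "e + inf t h \<le> inf t h"
    using \<open>inf t a \<le> h\<close> by (meson inf.cobounded1 le_inf_iff order_trans)
  then have "e \<le> 0"
    by (simp only: add_le_same_cancel2)
  moreover have "0 \<le> e"
    using h(1) s(1) by (simp add: e_def)
  ultimately have "inf h s = 0"
    unfolding e_def by (rule antisym)
  then have "inf (2 *\<^sub>R h) s = 0"
    using h(1) s(1) by (intro disjoint_scaleR) auto
  then have "inf s a = 0"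
    using h(2) by (simp add: inf_commute scaleR_2)
  then have "s \<le> y - a"
    using a assms(4,5) s by (intro disjoint_le_add_cancel[of s "y - a" a]) auto
  then have "s + inf t h \<le> (y - a) + h"
    by (intro add_mono) auto
  then have "t \<le> y - (h + h) + h"
    by (simp only: t h(2))
  then show ?thesis
    by (simp add: h_def[symmetric] algebra_simps)
qed

section \<open>Order convergence in terms of gauges\<close>

lemma order_convergent_imp_gauge_at_small:
  assumes "order_convergent A r x l" "directed_on A r" "atom a" "0 < e"
  shows "eventually (\<lambda>b. gauge_at a (x b - l) < e) (tails A r)"
proof -
  obtain G :: "'b set" and s y where G: "decreasing_to_0 G s y"
    "\<And>g. g \<in> G \<Longrightarrow> \<exists>a\<in>A. \<forall>b. (a, b) \<in> r \<longrightarrow> \<bar>x b - l\<bar> \<le> y g"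
    using assms(1) unfolding order_convergent_def by blast
  obtain g where g: "g \<in> G" "gauge_at a (y g) < e"
    using decreasing_to_0_gauge_at_small[OF G(1) assms(3,4)] by blast
  have "gauge_at a (x b - l) < e" if "\<bar>x b - l\<bar> \<le> y g" for b
    using gauge_at_mono[OF assms(3), of "x b - l" "y g"] that g(2) order_trans[OF that abs_ge_self]
    by simp
  then show ?thesis
    unfolding eventually_tails[OF assms(2)] using G(2)[OF g(1)] by blast
qed

text \<open>
  The eventual bounds of \<open>\<bar>x\<^sub>\<alpha> - l\<bar>\<close> themselves serve as the dominating net. An atom
  below all of them could be subtracted by halves indefinitely.
\<close>
lemma gauge_at_small_imp_order_convergent:
  fixes x :: "'i \<Rightarrow> 'a::archimedean_vector_lattice"
  assumes atomic: "atomic_space TYPE('a)"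
    and A: "directed_on A r"
    and bound: "\<And>b. b \<in> A \<Longrightarrow> \<bar>x b - l\<bar> \<le> w"
    and small: "\<And>a. atom a \<Longrightarrow> eventually (\<lambda>b. gauge_at a (x b - l) \<le> 1/2) (tails A r)"
  shows "order_convergent A r x l"
proof -
  define G where "G = {y. eventually (\<lambda>b. \<bar>x b - l\<bar> \<le> y) (tails A r)}"
  define s where "s = {(y, y'). y \<in> G \<and> y' \<in> G \<and> y' \<le> y}"
  have r: "A \<noteq> {}" "r \<subseteq> A \<times> A" "\<And>a. a \<in> A \<Longrightarrow> (a, a) \<in> r"
    using A unfolding directed_on_def preorder_on_def refl_on_def by blast+
  have w: "w \<in> G"
    unfolding G_def eventually_tails[OF A] mem_Collect_eq using r bound by blast
  have nonneg: "0 \<le> y" if "y \<in> G" for y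
    using that r(3) unfolding G_def eventually_tails[OF A] by (blast intro: order_trans[OF abs_ge_zero])
  have inf_G: "inf y y' \<in> G" if "y \<in> G" "y' \<in> G" for y y'
    using that unfolding G_def by (auto intro: eventually_conj)
  have "directed_on G s"
    unfolding directed_on_def
  proof (intro conjI ballI)
    show "G \<noteq> {}"
      using w by blast
    show "preorder_on G s"
      unfolding preorder_on_def s_def refl_on_def trans_def by (auto intro: order_trans)
    show "\<exists>v\<in>G. (y, v) \<in> s \<and> (y', v) \<in> s" if "y \<in> G" "y' \<in> G" for y y'
      using inf_G[OF that] that unfolding s_def by (intro bexI[of _ "inf y y'"]) auto
  qed
  moreover have "z \<le> 0" if z: "\<And>y. y \<in> G \<Longrightarrow> z \<le> y" for z
  proof (rule ccontr)
    assume "\<not> z \<le> 0"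
    then have "0 < sup z 0"
      by (metis less_le sup.cobounded1 sup.cobounded2)
    \<comment> \<open>Eventual bounds are positive, so \<open>z\<close> may be replaced by its positive part.\<close>
    then obtain a where a: "atom a" "a \<le> sup z 0"
      using atomic_space_positive_ge_atom[OF atomic] by blast
    have below: "a \<le> y" if "y \<in> G" for y
      using a(2) z[OF that] nonneg[OF that] by (meson order_trans sup_least)
    have half: "y - (1/2) *\<^sub>R a \<in> G" if y: "y \<in> G" for y
    proof -
      have "eventually (\<lambda>b. \<bar>x b - l\<bar> \<le> y) (tails A r)"
        using y by (simp add: G_def)
      then have "eventually (\<lambda>b. \<bar>x b - l\<bar> \<le> y - (1/2) *\<^sub>R a) (tails A r)"
        using small[OF a(1)]
      proof eventually_elim
        case (elim b)
        have "gauge_at a \<bar>x b - l\<bar> \<le> 1/2"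
          using elim(2) by (simp add: gauge_at_def)
        then show ?case
          using elim(1) below[OF y] a(1) by (intro lower_bound_by_half_atom) auto
      qed
      then show ?thesis
        by (simp add: G_def)
    qed
    have "w - real n *\<^sub>R ((1/2) *\<^sub>R a) \<in> G" for n
    proof (induction n)
      case (Suc n)
      have "real (Suc n) *\<^sub>R ((1/2) *\<^sub>R a) = real n *\<^sub>R ((1/2) *\<^sub>R a) + (1/2) *\<^sub>R a"
        unfolding of_nat_Suc by (simp only: scaleR_add_left scaleR_one add.commute)
      then show ?case
        using half[OF Suc] by (simp only: diff_diff_add)
    qed (use w in simp)
    then have "real n *\<^sub>R ((1/2) *\<^sub>R a) \<le> w" for n
      using nonneg by (metis diff_ge_0_iff_ge)
    then have "(1/2) *\<^sub>R a \<le> 0"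
      by (rule archimedean)
    then show False
      using a(1) scaleR_le_scaleR_pos_iff[of a "1/2" 0] by (simp add: atom_def)
  qed
  ultimately have "decreasing_to_0 G s (\<lambda>y. y)"
    unfolding decreasing_to_0_def using nonneg
    by (auto simp: s_def isGlb_def greatestP_def isLb_def setge_def setle_def)
  then show ?thesis
    by (rule order_convergentI) (simp add: G_def eventually_tails[OF A])
qed

section \<open>The topology of the gauges\<close>

text \<open>
  These are the sets open for the pseudometrics \<open>(y, z) \<mapsto> gauge_at a (y - z)\<close> with
  \<open>a\<close> ranging over all atoms; a basic neighbourhood restricts finitely many of them.
\<close>
definition gauge_open :: "'a::vector_lattice set \<Rightarrow> 'a set \<Rightarrow> bool" where
  "gauge_open B U \<longleftrightarrow> U \<subseteq> B \<and>
     (\<forall>l\<in>U. \<exists>F e. finite F \<and> F \<subseteq> {a. atom a} \<and> 0 < e \<and>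
        {z \<in> B. \<forall>a\<in>F. gauge_at a (z - l) < e} \<subseteq> U)"

definition gauge_topology :: "'a::vector_lattice set \<Rightarrow> 'a topology" where
  "gauge_topology B = topology (gauge_open B)"

lemma openin_gauge_topology: "openin (gauge_topology B) U \<longleftrightarrow> gauge_open B U"
proof -
  have "gauge_open B (S \<inter> T)" if ST: "gauge_open B S" "gauge_open B T" for S T
    unfolding gauge_open_def
  proof (intro conjI ballI)
    show "S \<inter> T \<subseteq> B"
      using ST by (auto simp: gauge_open_def)
    fix l assume "l \<in> S \<inter> T"
    then have l: "l \<in> S" "l \<in> T"
      by auto
    obtain F e where
      F: "finite F" "F \<subseteq> {a. atom a}" "0 < e" "{z \<in> B. \<forall>a\<in>F. gauge_at a (z - l) < e} \<subseteq> S"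
      using ST(1) l(1) unfolding gauge_open_def by blast
    obtain F' e' where
      F': "finite F'" "F' \<subseteq> {a. atom a}" "0 < e'" "{z \<in> B. \<forall>a\<in>F'. gauge_at a (z - l) < e'} \<subseteq> T"
      using ST(2) l(2) unfolding gauge_open_def by blast
    have "{z \<in> B. \<forall>a\<in>F \<union> F'. gauge_at a (z - l) < min e e'} \<subseteq> S \<inter> T"
      using F(4) F'(4) by auto
    then show "\<exists>F e. finite F \<and> F \<subseteq> {a. atom a} \<and> 0 < e \<and>
        {z \<in> B. \<forall>a\<in>F. gauge_at a (z - l) < e} \<subseteq> S \<inter> T"
      using F F' by (intro exI[of _ "F \<union> F'"] exI[of _ "min e e'"]) auto
  qed
  moreover have "gauge_open B (\<Union>\<K>)" if "\<forall>S\<in>\<K>. gauge_open B S" for \<K>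
    unfolding gauge_open_def
  proof (intro conjI ballI)
    show "\<Union>\<K> \<subseteq> B"
      using that by (auto simp: gauge_open_def)
    fix l assume "l \<in> \<Union>\<K>"
    then obtain S where S: "S \<in> \<K>" "l \<in> S"
      by blast
    then have "gauge_open B S"
      using that by blast
    then obtain F e where "finite F" "F \<subseteq> {a. atom a}" "0 < e"
        "{z \<in> B. \<forall>a\<in>F. gauge_at a (z - l) < e} \<subseteq> S"
      using S(2) unfolding gauge_open_def by blast
    then show "\<exists>F e. finite F \<and> F \<subseteq> {a. atom a} \<and> 0 < e \<and>
        {z \<in> B. \<forall>a\<in>F. gauge_at a (z - l) < e} \<subseteq> \<Union>\<K>"
      using S(1) by (intro exI[of _ F] exI[of _ e]) auto
  qed
  ultimately have "istopology (gauge_open B)"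
    by (simp add: istopology_def)
  then show ?thesis
    by (simp add: gauge_topology_def topology_inverse')
qed

lemma topspace_gauge_topology: "topspace (gauge_topology B) = B"
proof -
  have "gauge_open B B"
    unfolding gauge_open_def by (auto intro!: exI[of _ "{}"] exI[of _ 1])
  then show ?thesis
    unfolding topspace_def openin_gauge_topology by (auto simp: gauge_open_def)
qed

lemma gauge_open_ball:
  fixes a l :: "'a::vector_lattice"
  assumes a: "atom a"
  shows "gauge_open B {z \<in> B. gauge_at a (z - l) < e}"
  unfolding gauge_open_def
proof (intro conjI ballI)
  fix m assume m: "m \<in> {z \<in> B. gauge_at a (z - l) < e}"
  let ?d = "e - gauge_at a (m - l)"
  have "gauge_at a (z - l) < e" if "gauge_at a (z - m) < ?d" for z
    using gauge_at_add_le[OF a, of "z - m" "m - l"] that by simp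
  then have "{z \<in> B. \<forall>a\<in>{a}. gauge_at a (z - m) < ?d} \<subseteq> {z \<in> B. gauge_at a (z - l) < e}"
    by auto
  then show "\<exists>F d. finite F \<and> F \<subseteq> {a. atom a} \<and> 0 < d \<and>
      {z \<in> B. \<forall>a\<in>F. gauge_at a (z - m) < d} \<subseteq> {z \<in> B. gauge_at a (z - l) < e}"
    using a m by (intro exI[of _ "{a}"] exI[of _ ?d]) auto
qed blast

lemma limitin_gauge_topology:
  fixes l :: "'a::vector_lattice"
  assumes l: "l \<in> B" and x: "eventually (\<lambda>b. x b \<in> B) F"
  shows "limitin (gauge_topology B) x l F \<longleftrightarrow>
    (\<forall>a e. atom a \<longrightarrow> 0 < e \<longrightarrow> eventually (\<lambda>b. gauge_at a (x b - l) < e) F)"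
proof (intro iffI allI impI)
  fix a :: 'a and e :: real
  assume lim: "limitin (gauge_topology B) x l F" and a: "atom a" "0 < e"
  have "l \<in> {z \<in> B. gauge_at a (z - l) < e}"
    using l a by (simp add: gauge_at_0)
  then have "eventually (\<lambda>b. x b \<in> {z \<in> B. gauge_at a (z - l) < e}) F"
    using lim gauge_open_ball[OF a(1), of B l e] unfolding limitin_def openin_gauge_topology by blast
  then show "eventually (\<lambda>b. gauge_at a (x b - l) < e) F"
    by (rule eventually_mono) simp
next
  assume small: "\<forall>a e. atom a \<longrightarrow> 0 < e \<longrightarrow> eventually (\<lambda>b. gauge_at a (x b - l) < e) F"
  show "limitin (gauge_topology B) x l F"
    unfolding limitin_def topspace_gauge_topology openin_gauge_topology
  proof (intro conjI allI impI)
    fix U assume "gauge_open B U \<and> l \<in> U"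
    then obtain S e where S: "finite S" "S \<subseteq> {a. atom a}" "0 < e"
        "{z \<in> B. \<forall>a\<in>S. gauge_at a (z - l) < e} \<subseteq> U"
      unfolding gauge_open_def by blast
    have "eventually (\<lambda>b. \<forall>a\<in>S. gauge_at a (x b - l) < e) F"
      using S small by (intro eventually_ball_finite) auto
    with x show "eventually (\<lambda>b. x b \<in> U) F"
      by eventually_elim (use S(4) in auto)
  qed (rule l)
qed

section \<open>Order convergence is topological on order bounded sets\<close>

lemma gauge_topology_describes_order_convergence:
  fixes B :: "'a::archimedean_vector_lattice set"
  assumes "atomic_space TYPE('a)" "order_bounded B"
  shows "describes_order_convergence TYPE('i) B (gauge_topology B)"
  unfolding describes_order_convergence_def
proof (intro allI impI)
  fix A :: "'i set" and r x l
  assume A: "directed_on A r" and x: "x ` A \<subseteq> B" and l: "l \<in> B"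
  obtain u v where B: "B \<subseteq> {u..v}"
    using assms(2) unfolding order_bounded_def by blast
  have bound: "\<bar>x b - l\<bar> \<le> v - u" if "b \<in> A" for b
  proof -
    have "x b \<in> {u..v}" "l \<in> {u..v}"
      using B x l that by blast+
    then have "u \<le> x b" "x b \<le> v" "u \<le> l" "l \<le> v"
      by auto
    then show ?thesis
      using diff_mono[of "x b" v u l] diff_mono[of l v u "x b"] by (intro abs_leI) auto
  qed
  have "A \<noteq> {}" "r \<subseteq> A \<times> A"
    using A unfolding directed_on_def preorder_on_def by blast+
  then have "eventually (\<lambda>b. x b \<in> B) (tails A r)"
    unfolding eventually_tails[OF A] using x by blast
  then have lim: "limitin (gauge_topology B) x l (tails A r) \<longleftrightarrow>
      (\<forall>a e. atom a \<longrightarrow> 0 < e \<longrightarrow> eventually (\<lambda>b. gauge_at a (x b - l) < e) (tails A r))"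
    using l by (intro limitin_gauge_topology)
  show "order_convergent A r x l \<longleftrightarrow> limitin (gauge_topology B) x l (tails A r)"
  proof
    assume "order_convergent A r x l"
    then show "limitin (gauge_topology B) x l (tails A r)"
      unfolding lim using order_convergent_imp_gauge_at_small A by blast
  next
    assume "limitin (gauge_topology B) x l (tails A r)"
    then have small: "eventually (\<lambda>b. gauge_at a (x b - l) < e) (tails A r)"
      if "atom a" "0 < e" for a e
      using lim that by blast
    have "eventually (\<lambda>b. gauge_at a (x b - l) \<le> 1/2) (tails A r)" if "atom a" for a
      by (rule eventually_mono[OF small[OF that, of "1/2"]]) auto
    then show "order_convergent A r x l"
      using assms(1) A bound by (intro gauge_at_small_imp_order_convergent)
  qed
qed

theorem corollary1:
  fixes B :: "'a::archimedean_vector_lattice set"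
  assumes "atomic_space TYPE('a)"
    and "order_bounded B"
  shows "\<exists>T. topspace T = B
           \<and> describes_order_convergence TYPE('a set \<times> 'a) B T
           \<and> describes_order_convergence TYPE('i) B T"
  by (intro exI[of _ "gauge_topology B"] conjI topspace_gauge_topology
      gauge_topology_describes_order_convergence assms)

end
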